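(* Consider an instance of the two-stage robust problem and its $k$-adaptability counterpart with second-stage dimension $n$, belonging to a problem class with second-stage cardinality bounds $\underline p,\bar p$ and with cost bounds $0<m_\infty\le M_\infty$. Let $M(n):=M_\infty\,\bar p(n)-m_\infty\,\underline p(n)$, let $a:\mathbb N\to\mathbb R_+$ with $M(n)+a(n)>0$, and let $k=n-l$. Then $$\mathrm{adapt}(k)\le\mathrm{opt}(2RO)+a(n)$$ for all $$l\in\left[0,\ \min\left\{n-1,\ \frac{a(n)\,n}{M(n)+a(n)}\right\}\right]\cap\mathbb N.$$
   Context: Notation: $\mathbb N=\{1,2,\dots\}$, $[k]=\{1,\dots,k\}$, $\mathbb R_+^n=\{y\in\mathbb R^n:y\ge0\}$, and $\|y\|_0$ is the number of non-zero entries of $y$. An instance consists of a nonempty first-stage set $X\subseteq\mathbb R^m$, nonempty second-stage sets $Y(x)\subseteq\{0,1\}^n$ for $x\in X$, a nonempty convex uncertainty set $U\subseteq\mathbb R_+^n$ and first-stage costs $d\in\mathbb R_+^m$; all minima and maxima written are understood to be attained. The two-stage robust problem is $$\min_{x\in X}\ \max_{\xi\in U}\ \min_{y\in Y(x)}\ d^\top x+\xi^\top y,$$ with optimal value $\mathrm{opt}(2RO)$. For $k\in\mathbb N$ the $k$-adaptability problem is $$\min_{x\in X,\ y^1,\dots,y^k\in Y(x)}\ \max_{\xi\in U}\ \min_{i=1,\dots,k}\ d^\top x+\xi^\top y^i,$$ with optimal value $\mathrm{adapt}(k)$. A problem class has second-stage cardinality bounds $\underline p,\bar p:\mathbb N\to\mathbb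 R_+$ if for every instance with $n$ second-stage variables $\underline p(n)\le\|y\|_0\le\bar p(n)$ for all $x\in X$ and $y\in Y(x)$. Cost bounds $0<m_\infty\le M_\infty$ means that $m_\infty\le\xi_j\le M_\infty$ for all $\xi\in U$ and $j\in[n]$. *)

theory Defs
  imports Complex_Main "Jordan_Normal_Form.Matrix"
begin

text \<open>Vectors in the space of real n-tuples are elements of \<open>carrier_vec n\<close>; coordinates are
  indexed by \<open>{0..<n}\<close> instead of \<open>{1..n}\<close>.\<close>

record ro_instance =
  fst_dim :: nat
  snd_dim :: nat
  fst_stage :: "real vec set"
  snd_stage :: "real vec \<Rightarrow> real vec set"
  uncertainty :: "real vec set"
  fst_cost :: "real vec"

definition nonneg_vecs :: "nat \<Rightarrow> real vec set" where
  "nonneg_vecs n = {v \<in> carrier_vec n. 0\<^sub>v n \<le> v}"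

definition binary_vecs :: "nat \<Rightarrow> real vec set" where
  "binary_vecs n = {v \<in> carrier_vec n. \<forall>j<n. v $ j \<in> {0, 1}}"

text \<open>The library predicate \<open>convex\<close> lives in the class \<open>real_vector\<close>, which \<open>real vec\<close>,
  containing vectors of all dimensions, cannot instantiate.\<close>

definition convex_vecs :: "real vec set \<Rightarrow> bool" where
  "convex_vecs S \<longleftrightarrow>
     (\<forall>u\<in>S. \<forall>v\<in>S. \<forall>s\<ge>0. \<forall>t\<ge>0. s + t = 1 \<longrightarrow> s \<cdot>\<^sub>v u + t \<cdot>\<^sub>v v \<in> S)"

definition norm0 :: "real vec \<Rightarrow> nat" where
  "norm0 v = card {j. j < dim_vec v \<and> v $ j \<noteq> 0}"

definition valid_instance :: "ro_instance \<Rightarrow> bool" where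
  "valid_instance I \<longleftrightarrow>
     1 \<le> fst_dim I \<and> 1 \<le> snd_dim I \<and>
     fst_stage I \<noteq> {} \<and> fst_stage I \<subseteq> carrier_vec (fst_dim I) \<and>
     (\<forall>x\<in>fst_stage I. snd_stage I x \<noteq> {} \<and> snd_stage I x \<subseteq> binary_vecs (snd_dim I)) \<and>
     uncertainty I \<noteq> {} \<and> uncertainty I \<subseteq> nonneg_vecs (snd_dim I) \<and>
     convex_vecs (uncertainty I) \<and>
     fst_cost I \<in> nonneg_vecs (fst_dim I)"

definition total_cost :: "ro_instance \<Rightarrow> real vec \<Rightarrow> real vec \<Rightarrow> real vec \<Rightarrow> real" where
  "total_cost I x \<xi> y = fst_cost I \<bullet> x + \<xi> \<bullet> y"

text \<open>Minima and maxima are written as real infima and suprema; these have the intended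
  meaning under \<open>two_stage_attained\<close> and \<open>adapt_attained\<close> below. The innermost minima range over
  finite nonempty sets, so they are always attained.\<close>

definition attains_min_on :: "('a \<Rightarrow> real) \<Rightarrow> 'a set \<Rightarrow> bool" where
  "attains_min_on f A \<longleftrightarrow> (\<exists>a\<in>A. \<forall>b\<in>A. f a \<le> f b)"

definition attains_max_on :: "('a \<Rightarrow> real) \<Rightarrow> 'a set \<Rightarrow> bool" where
  "attains_max_on f A \<longleftrightarrow> (\<exists>a\<in>A. \<forall>b\<in>A. f b \<le> f a)"

definition recourse_cost :: "ro_instance \<Rightarrow> real vec \<Rightarrow> real vec \<Rightarrow> real" where
  "recourse_cost I x \<xi> = (INF y\<in>snd_stage I x. total_cost I x \<xi> y)"

definition worst_case :: "ro_instance \<Rightarrow> real vec \<Rightarrow> real" where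
  "worst_case I x = (SUP \<xi>\<in>uncertainty I. recourse_cost I x \<xi>)"

definition opt_2RO :: "ro_instance \<Rightarrow> real" where
  "opt_2RO I = (INF x\<in>fst_stage I. worst_case I x)"

definition two_stage_attained :: "ro_instance \<Rightarrow> bool" where
  "two_stage_attained I \<longleftrightarrow>
     attains_min_on (worst_case I) (fst_stage I) \<and>
     (\<forall>x\<in>fst_stage I. attains_max_on (recourse_cost I x) (uncertainty I))"

text \<open>A feasible solution is a pair of \<open>x\<close> and a family \<open>ys\<close> of not necessarily distinct
  second-stage solutions indexed by \<open>{1..k}\<close>.\<close>

definition adapt_feasible :: "ro_instance \<Rightarrow> nat \<Rightarrow> (real vec \<times> (nat \<Rightarrow> real vec)) set" where
  "adapt_feasible I k = (SIGMA x:fst_stage I. {1..k} \<rightarrow>\<^sub>E snd_stage I x)"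

definition adapt_recourse_cost ::
    "ro_instance \<Rightarrow> nat \<Rightarrow> real vec \<times> (nat \<Rightarrow> real vec) \<Rightarrow> real vec \<Rightarrow> real" where
  "adapt_recourse_cost I k = (\<lambda>(x, ys) \<xi>. INF i\<in>{1..k}. total_cost I x \<xi> (ys i))"

definition adapt_worst_case ::
    "ro_instance \<Rightarrow> nat \<Rightarrow> real vec \<times> (nat \<Rightarrow> real vec) \<Rightarrow> real" where
  "adapt_worst_case I k p = (SUP \<xi>\<in>uncertainty I. adapt_recourse_cost I k p \<xi>)"

definition adapt :: "ro_instance \<Rightarrow> nat \<Rightarrow> real" where
  "adapt I k = (INF p\<in>adapt_feasible I k. adapt_worst_case I k p)"

definition adapt_attained :: "ro_instance \<Rightarrow> nat \<Rightarrow> bool" where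
  "adapt_attained I k \<longleftrightarrow>
     attains_min_on (adapt_worst_case I k) (adapt_feasible I k) \<and>
     (\<forall>p\<in>adapt_feasible I k. attains_max_on (adapt_recourse_cost I k p) (uncertainty I))"

text \<open>A problem class is a set of instances, possibly of different dimensions. Functions on
  \<open>{1, 2, \<dots>}\<close> are total on \<open>nat\<close> here, with an irrelevant value at 0.\<close>

definition nonneg_seq :: "(nat \<Rightarrow> real) \<Rightarrow> bool" where
  "nonneg_seq f \<longleftrightarrow> (\<forall>n\<ge>1. 0 \<le> f n)"

definition cardinality_bounds ::
    "ro_instance set \<Rightarrow> (nat \<Rightarrow> real) \<Rightarrow> (nat \<Rightarrow> real) \<Rightarrow> bool" where
  "cardinality_bounds C p_lo p_up \<longleftrightarrow>
     nonneg_seq p_lo \<and> nonneg_seq p_up \<and>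
     (\<forall>I\<in>C. \<forall>x\<in>fst_stage I. \<forall>y\<in>snd_stage I x.
        p_lo (snd_dim I) \<le> real (norm0 y) \<and> real (norm0 y) \<le> p_up (snd_dim I))"

definition cost_bounds :: "ro_instance \<Rightarrow> real \<Rightarrow> real \<Rightarrow> bool" where
  "cost_bounds I m_inf M_inf \<longleftrightarrow>
     0 < m_inf \<and> m_inf \<le> M_inf \<and>
     (\<forall>\<xi>\<in>uncertainty I. \<forall>j<snd_dim I. m_inf \<le> \<xi> $ j \<and> \<xi> $ j \<le> M_inf)"

end

theory Submission
  imports Defs "Jordan_Normal_Form.Determinant"
begin

text \<open>
  Let \<open>x\<close> be optimal for the two-stage problem and let \<open>c\<close> be its optimal value minus the
  first-stage cost of \<open>x\<close>. Every \<open>\<xi> \<in> U\<close> has some \<open>y \<in> Y(x)\<close> with \<open>\<xi> \<bullet> y \<le> c\<close>, so a theorem of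
  the alternative yields one convex combination of \<open>Y(x)\<close> with cost at most \<open>c\<close> for all \<open>\<xi>\<close>
  simultaneously. As costs and solutions are nonnegative, a Caratheodory-type reduction, which may
  also scale the combination down, leaves at most \<open>n\<close> solutions of positive weight. The \<open>k\<close>
  heaviest of them carry a weight \<open>\<kappa> \<ge> k / n\<close>. If all of these cost more than \<open>c + a\<close> under
  some \<open>\<xi>\<close>, then bounding the discarded ones from below gives \<open>a < (1 - \<kappa>) * M\<close>, while the
  choice of \<open>l\<close> gives \<open>(1 - \<kappa>) * (M + a) \<le> a\<close>.
\<close>

section \<open>A theorem of the alternative for finitely many functions\<close>

text \<open>Stands for a family of functions affine on a convex set, with no vector space structure
  on \<open>'u\<close>. A single \<open>w\<close> has to realise the combination for all indices at
  once.\<close>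

definition convexlike :: "('u \<Rightarrow> 'i \<Rightarrow> real) \<Rightarrow> 'u set \<Rightarrow> bool" where
  "convexlike f U \<longleftrightarrow> (\<forall>u\<in>U. \<forall>v\<in>U. \<forall>s\<ge>0. \<forall>t\<ge>0. s + t = 1 \<longrightarrow>
     (\<exists>w\<in>U. \<forall>i. f w i = s * f u i + t * f v i))"

lemma convexlikeE:
  assumes "convexlike f U" "u \<in> U" "v \<in> U" "0 \<le> s" "0 \<le> t" "s + t = 1"
  obtains w where "w \<in> U" "\<And>i. f w i = s * f u i + t * f v i"
  using assms unfolding convexlike_def by blast

text \<open>For \<open>t > 0\<close> the claim asks for a ratio \<open>r \<ge> 0\<close> with
  \<open>f u + r * g u \<le> 0\<close> on \<open>U\<close>. Points with \<open>g u > 0\<close> bound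
  \<open>r\<close> above by \<open>- f u / g u\<close>, points with \<open>f u > 0\<close> bound it
  below by \<open>f u / - g u\<close>. Convexity keeps every lower bound below every upper bound
  (\<open>cross\<close>).\<close>

lemma two_function_alternative:
  fixes f g :: "'u \<Rightarrow> real"
  assumes conv: "\<And>u v s t. u \<in> U \<Longrightarrow> v \<in> U \<Longrightarrow> 0 \<le> s \<Longrightarrow> 0 \<le> t \<Longrightarrow> s + t = 1 \<Longrightarrow>
      \<exists>w\<in>U. f w = s * f u + t * f v \<and> g w = s * g u + t * g v"
    and alt: "\<And>u. u \<in> U \<Longrightarrow> f u \<le> 0 \<or> g u \<le> 0"
  shows "\<exists>t. 0 \<le> t \<and> t \<le> 1 \<and> (\<forall>u\<in>U. t * f u + (1 - t) * g u \<le> 0)"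
proof (cases "\<exists>v\<in>U. g v > 0")
  case False
  then show ?thesis by (intro exI[of _ 0]) force
next
  case True
  have cross: "f u * g v \<le> f v * g u" if u: "u \<in> U" "f u > 0" and v: "v \<in> U" "g v > 0" for u v
  proof (rule ccontr)
    assume "\<not> ?thesis"
    then have less: "f v * g u < f u * g v" by simp
    have gu: "g u \<le> 0" and fv: "f v \<le> 0" using alt u v by force+
    define p where "p = g v - g u"
    define q where "q = f u - f v"
    have p: "p > 0" and q: "q > 0" using gu fv u v by (auto simp: p_def q_def)
    \<comment> \<open>On the segment from \<open>v\<close> to \<open>u\<close>, \<open>f\<close> is positive beyond \<open>- f v / q\<close> and \<open>g\<close> before
      \<open>g v / p\<close>; the failure of the claim says that these ranges overlap.\<close>
    have lt: "- f v / q < g v / p" using p q less by (simp add: p_def q_def field_simps)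
    then obtain s where s: "- f v / q < s" "s < g v / p" using dense by blast
    have s0: "0 \<le> s" using s fv q by (smt (verit) divide_nonneg_pos)
    have "g v / p \<le> 1" using p gu by (simp add: p_def)
    then have s1: "s \<le> 1" using s by linarith
    obtain w where w: "w \<in> U" "f w = s * f u + (1 - s) * f v" "g w = s * g u + (1 - s) * g v"
      using conv[of u v s "1 - s"] u v s0 s1 by auto
    have "f w = s * q + f v" "g w = g v - s * p" using w by (auto simp: p_def q_def algebra_simps)
    then have "f w > 0" "g w > 0" using s p q by (auto simp: field_simps)
    then show False using alt[OF w(1)] by simp
  qed
  define R where "R = (\<lambda>v. - f v / g v) ` {v\<in>U. g v > 0}"
  \<comment> \<open>The infimum of the upper bounds is itself admissible. If \<open>f\<close> is
    nowhere positive, the ratio 0 serves.\<close>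
  define r where "r = (if \<exists>u\<in>U. f u > 0 then Inf R else 0)"
  have R0: "0 \<le> x" if "x \<in> R" for x
    using that alt by (fastforce simp: R_def intro!: divide_nonpos_pos)
  have Rne: "R \<noteq> {}" using True by (auto simp: R_def)
  have Rbdd: "bdd_below R" using R0 by (meson bdd_below.I)
  have r0: "0 \<le> r" using cInf_greatest[OF Rne] R0 by (auto simp: r_def)
  have key: "r * g u + f u \<le> 0" if u: "u \<in> U" for u
  proof (cases "g u > 0")
    case gpos: True
    have "r \<le> - f u / g u"
    proof (cases "\<exists>u\<in>U. f u > 0")
      case True
      then show ?thesis using cInf_lower[OF _ Rbdd] u gpos by (auto simp: r_def R_def)
    next
      case False
      then have "r = 0" "f u \<le> 0" using u by (auto simp: r_def not_less)
      then show ?thesis using gpos by (simp add: divide_nonpos_pos)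
    qed
    then show ?thesis using gpos by (simp add: field_simps)
  next
    case gle: False
    show ?thesis
    proof (cases "f u > 0")
      case fpos: True
      obtain v where v: "v \<in> U" "g v > 0" using True by blast
      \<comment> \<open>At a zero of \<open>g\<close> no ratio could repair \<open>f u > 0\<close>;
        comparison with a point where \<open>g\<close> is positive excludes this.\<close>
      have "g u \<noteq> 0"
      proof
        assume "g u = 0"
        then have "f u * g v \<le> 0" using cross[OF u fpos v] by simp
        then show False using fpos v by (simp add: mult_le_0_iff)
      qed
      then have gneg: "g u < 0" using gle by simp
      have "f u / - g u \<le> Inf R"
      proof (rule cInf_greatest[OF Rne])
        fix x assume "x \<in> R"
        then obtain v where v: "v \<in> U" "g v > 0" "x = - f v / g v" by (auto simp: R_def)
        show "f u / - g u \<le> x" unfolding v(3)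
          using cross[OF u fpos v(1,2)] v(2) gneg by (simp add: field_simps)
      qed
      moreover have "r = Inf R" using u fpos by (auto simp: r_def)
      ultimately show ?thesis using gneg by (simp add: field_simps)
    next
      case False
      then show ?thesis using gle r0 by (smt (verit) mult_nonneg_nonpos)
    qed
  qed
  \<comment> \<open>Scales the weights 1 and \<open>r\<close> to total 1.\<close>
  define t where "t = 1 / (1 + r)"
  have t: "0 \<le> t" "t \<le> 1" using r0 by (auto simp: t_def)
  have "1 - t = t * r" using r0 by (simp add: t_def field_simps)
  then have "t * f u + (1 - t) * g u = t * (r * g u + f u)" for u by (simp add: distrib_left)
  then have "\<forall>u\<in>U. t * f u + (1 - t) * g u \<le> 0" using key t by (simp add: mult_nonneg_nonpos)
  then show ?thesis using t by blast
qed

text \<open>Induction on \<open>S\<close>. Where \<open>f u j > 0\<close>, some index of the smaller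
  set must be nonpositive, and this region is again convexlike since combinations of positive values
  are positive. The weights found there merge \<open>S\<close> into one function, which the
  two-function case combines with index \<open>j\<close>.\<close>

lemma convexlike_alternative:
  fixes f :: "'u \<Rightarrow> 'i \<Rightarrow> real"
  assumes "finite S" "S \<noteq> {}" "convexlike f U" "\<And>u. u \<in> U \<Longrightarrow> \<exists>i\<in>S. f u i \<le> 0"
  shows "\<exists>w. (\<forall>i\<in>S. 0 \<le> w i) \<and> sum w S = 1 \<and> (\<forall>u\<in>U. (\<Sum>i\<in>S. w i * f u i) \<le> 0)"
  using assms
proof (induction S arbitrary: U rule: finite_ne_induct)
  case (singleton i)
  then show ?case by (intro exI[of _ "\<lambda>_. 1"]) auto
next
  case (insert j S)
  define V where "V = {u\<in>U. f u j > 0}"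
  have "convexlike f V"
    unfolding convexlike_def
  proof (intro ballI allI impI)
    fix u v :: 'u and s t :: real
    assume uv: "u \<in> V" "v \<in> V" and st: "0 \<le> s" "0 \<le> t" "s + t = 1"
    then obtain w where w: "w \<in> U" "\<And>i. f w i = s * f u i + t * f v i"
      using convexlikeE[OF insert.prems(1), of u v s t] by (auto simp: V_def)
    have "s * f u j + t * f v j > 0"
      using uv st by (cases "s = 0") (auto simp: V_def intro: add_pos_nonneg)
    then show "\<exists>w\<in>V. \<forall>i. f w i = s * f u i + t * f v i"
      using w by (auto simp: V_def intro!: bexI[of _ w])
  qed
  moreover have "\<And>u. u \<in> V \<Longrightarrow> \<exists>i\<in>S. f u i \<le> 0"
    using insert.prems(2) by (force simp: V_def)
  ultimately obtain w where w: "\<forall>i\<in>S. 0 \<le> w i" "sum w S = 1"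
      "\<forall>u\<in>V. (\<Sum>i\<in>S. w i * f u i) \<le> 0"
    using insert.IH by blast
  have "\<exists>t. 0 \<le> t \<and> t \<le> 1 \<and>
      (\<forall>u\<in>U. t * f u j + (1 - t) * (\<Sum>i\<in>S. w i * f u i) \<le> 0)"
  proof (rule two_function_alternative)
    fix u v :: 'u and s t :: real
    assume "u \<in> U" "v \<in> U" "0 \<le> s" "0 \<le> t" "s + t = 1"
    then obtain z where z: "z \<in> U" "\<And>i. f z i = s * f u i + t * f v i"
      using convexlikeE[OF insert.prems(1), of u v s t] by blast
    then show "\<exists>z\<in>U. f z j = s * f u j + t * f v j \<and> (\<Sum>i\<in>S. w i * f z i) =
        s * (\<Sum>i\<in>S. w i * f u i) + t * (\<Sum>i\<in>S. w i * f v i)"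
      by (intro bexI[of _ z])
        (auto simp: sum_distrib_left sum.distrib[symmetric] algebra_simps intro!: sum.cong)
  next
    fix u assume "u \<in> U"
    then show "f u j \<le> 0 \<or> (\<Sum>i\<in>S. w i * f u i) \<le> 0"
      using w(3) by (force simp: V_def)
  qed
  then obtain t where t: "0 \<le> t" "t \<le> 1"
      "\<forall>u\<in>U. t * f u j + (1 - t) * (\<Sum>i\<in>S. w i * f u i) \<le> 0" by blast
  define w' where "w' i = (if i = j then t else (1 - t) * w i)" for i
  have [simp]: "w' j = t" by (simp add: w'_def)
  have w'S: "(\<Sum>i\<in>S. w' i * h i) = (1 - t) * (\<Sum>i\<in>S. w i * h i)" for h :: "'i \<Rightarrow> real"
    unfolding sum_distrib_left using insert.hyps
    by (intro sum.cong) (auto simp: w'_def algebra_simps)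
  have "sum w' (insert j S) = 1"
    using w'S[of "\<lambda>_. 1"] w insert.hyps by simp
  moreover have "\<forall>i\<in>insert j S. 0 \<le> w' i" using t w by (auto simp: w'_def)
  moreover have "\<forall>u\<in>U. (\<Sum>i\<in>insert j S. w' i * f u i) \<le> 0"
    using t(3) insert.hyps by (simp add: w'S)
  ultimately show ?case by blast
qed

section \<open>Caratheodory reduction for nonnegative vectors\<close>

text \<open>More than \<open>n\<close> vectors of length \<open>n\<close> are dependent. Taken as
  columns and padded with zero rows they form a singular square matrix, whose kernel supplies the
  coefficients.\<close>

lemma exists_linear_dependence:
  fixes f :: "'i \<Rightarrow> nat \<Rightarrow> real"
  assumes "finite T" "n < card T"
  shows "\<exists>\<mu>. (\<exists>i\<in>T. \<mu> i \<noteq> 0) \<and> (\<forall>j<n. (\<Sum>i\<in>T. \<mu> i * f i j) = 0)"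
proof -
  define N where "N = card T"
  obtain e where e: "bij_betw e {0..<N} T"
    using ex_bij_betw_nat_finite[OF assms(1)] by (auto simp: N_def)
  define A where "A = mat N N (\<lambda>(j, i). if j < n then f (e i) j else 0)"
  have A: "A \<in> carrier_mat N N" by (simp add: A_def)
  have "det A = 0"
  proof -
    \<comment> \<open>Row \<open>n\<close> of \<open>A\<close> exists because \<open>n < N\<close>,
      and it is a padding row.\<close>
    have "transpose_mat A *\<^sub>v unit_vec N n = 0\<^sub>v N"
      using assms(2) by (intro eq_vecI) (auto simp: A_def N_def)
    moreover have "unit_vec N n \<noteq> (0\<^sub>v N :: real vec)" using assms(2) by (simp add: N_def)
    ultimately have "det (transpose_mat A) = 0"
      using det_0_iff_vec_prod_zero[of "transpose_mat A" N] A unit_vec_carrier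
      by (metis transpose_carrier_mat)
    then show ?thesis using det_transpose[OF A] by simp
  qed
  then obtain v where v: "v \<in> carrier_vec N" "v \<noteq> 0\<^sub>v N" "A *\<^sub>v v = 0\<^sub>v N"
    using det_0_iff_vec_prod_zero[OF A] by blast
  define \<mu> where "\<mu> i = v $ (the_inv_into {0..<N} e i)" for i
  have \<mu>e: "\<mu> (e i) = v $ i" if "i < N" for i
    using that the_inv_into_f_f[OF bij_betw_imp_inj_on[OF e]] by (simp add: \<mu>_def)
  obtain i where i: "i < N" "v $ i \<noteq> 0" using v(1,2) by (metis carrier_vecD eq_vecI index_zero_vec)
  have "(\<Sum>i\<in>T. \<mu> i * f i j) = 0" if j: "j < n" for j
  proof -
    have "(\<Sum>i\<in>T. \<mu> i * f i j) = (\<Sum>i\<in>{0..<N}. \<mu> (e i) * f (e i) j)"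
      using sum.reindex_bij_betw[OF e, of "\<lambda>i. \<mu> i * f i j"] by simp
    also have "\<dots> = (A *\<^sub>v v) $ j"
      using j assms(2) v(1) by (auto simp: A_def N_def scalar_prod_def \<mu>e[unfolded N_def] intro!: sum.cong)
    also have "\<dots> = 0" using j assms(2) by (simp add: v(3) N_def)
    finally show ?thesis .
  qed
  moreover have "e i \<in> T" using e i(1) by (auto dest: bij_betwE)
  ultimately show ?thesis using i \<mu>e by metis
qed

text \<open>One step of the Caratheodory reduction. A plain convex combination would only allow
  \<open>n + 1\<close> points; decreasing the combination by a factor saves one.\<close>

lemma conic_caratheodory_step:
  fixes f :: "'i \<Rightarrow> nat \<Rightarrow> real"
  assumes S: "finite S" "n < card S" and "1 \<le> n"
    and w: "\<And>i. i \<in> S \<Longrightarrow> 0 < w i" "sum w S = 1"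
    and f: "\<And>i j. i \<in> S \<Longrightarrow> j < n \<Longrightarrow> 0 \<le> f i j"
  shows "\<exists>T w'. T \<subset> S \<and> (\<forall>i\<in>T. 0 < w' i) \<and> sum w' T = 1 \<and>
     (\<forall>j<n. (\<Sum>i\<in>T. w' i * f i j) \<le> (\<Sum>i\<in>S. w i * f i j))"
proof -
  obtain \<mu>' where \<mu>': "\<exists>i\<in>S. \<mu>' i \<noteq> 0" "\<And>j. j < n \<Longrightarrow> (\<Sum>i\<in>S. \<mu>' i * f i j) = 0"
    using exists_linear_dependence[OF S] by blast
  \<comment> \<open>The sign is chosen so that subtracting a positive multiple of
    \<open>\<mu>\<close> cannot lower the total weight.\<close>
  define \<mu> where "\<mu> i = (if sum \<mu>' S \<le> 0 then \<mu>' i else - \<mu>' i)" for i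
  have \<mu>: "\<exists>i\<in>S. \<mu> i \<noteq> 0" using \<mu>'(1) by (auto simp: \<mu>_def)
  have \<mu>f: "(\<Sum>i\<in>S. \<mu> i * f i j) = 0" if "j < n" for j
    using \<mu>'(2)[OF that] by (cases "sum \<mu>' S \<le> 0") (simp_all add: \<mu>_def sum_negf)
  have \<sigma>: "sum \<mu> S \<le> 0"
    by (cases "sum \<mu>' S \<le> 0") (simp_all add: \<mu>_def sum_negf)
  show ?thesis
  proof (cases "\<exists>i\<in>S. \<mu> i > 0")
    case False
    \<comment> \<open>With all coefficients nonpositive and all \<open>f\<close> nonnegative, a
      vanishing sum forces every coordinate of this point to be 0; alone it is a combination below
      any other.\<close>
    then obtain i where i: "i \<in> S" "\<mu> i < 0" using \<mu> by force
    have fi: "f i j = 0" if j: "j < n" for j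
    proof -
      have "(\<Sum>i\<in>S. - \<mu> i * f i j) = 0" using \<mu>f[OF j] by (simp add: sum_negf)
      then have "- \<mu> i * f i j = 0"
        using sum_nonneg_eq_0_iff[OF S(1), of "\<lambda>i. - \<mu> i * f i j"] False f j i
        by (smt (verit) mult_nonneg_nonneg)
      then show ?thesis using i by simp
    qed
    have "{i} \<subset> S"
    proof -
      have "S \<noteq> {i}" using S(2) \<open>1 \<le> n\<close> by auto
      then show ?thesis using i by blast
    qed
    moreover have "0 \<le> (\<Sum>i\<in>S. w i * f i j)" if "j < n" for j
      using f that w by (intro sum_nonneg mult_nonneg_nonneg) (auto intro: less_imp_le)
    ultimately show ?thesis using fi by (intro exI[of _ "{i}"] exI[of _ "\<lambda>_. 1"]) auto
  next
    case True
    define P where "P = {i\<in>S. \<mu> i > 0}"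
    have P: "finite P" "P \<noteq> {}" using True S by (auto simp: P_def)
    obtain p where p: "p \<in> P" and pmin: "\<And>i. i \<in> P \<Longrightarrow> w p / \<mu> p \<le> w i / \<mu> i"
      using ex_is_arg_min_if_finite[OF P, of "\<lambda>i. w i / \<mu> i"]
      by (auto simp: is_arg_min_linorder)
    \<comment> \<open>The longest step that keeps all weights nonnegative; it makes the weight of
      \<open>p\<close> vanish.\<close>
    define t where "t = w p / \<mu> p"
    have t: "0 < t" using p w by (auto simp: t_def P_def)
    define v where "v i = w i - t * \<mu> i" for i
    have v0: "0 \<le> v i" if "i \<in> S" for i
    proof (cases "\<mu> i > 0")
      case True
      then have "t \<le> w i / \<mu> i" using pmin that by (auto simp: P_def t_def)
      then show ?thesis using True by (simp add: v_def field_simps)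
    next
      case False
      then have "t * \<mu> i \<le> 0" using t by (simp add: mult_nonneg_nonpos)
      then show ?thesis using w(1)[OF that] by (simp add: v_def)
    qed
    have vp: "v p = 0" "p \<in> S" using p by (auto simp: v_def t_def P_def)
    define s where "s = sum v S"
    have "s = 1 - t * sum \<mu> S" by (simp add: s_def v_def sum_subtractf w sum_distrib_left)
    \<comment> \<open>Since the total is at least 1, normalising by \<open>s\<close> only shrinks
      the nonnegative coordinate sums.\<close>
    then have s: "1 \<le> s" using \<sigma> t by (simp add: mult_nonneg_nonpos)
    define T where "T = {i\<in>S. 0 < v i}"
    have sumT: "(\<Sum>i\<in>T. v i * h i) = (\<Sum>i\<in>S. v i * h i)" for h :: "'i \<Rightarrow> real"
      using S(1) v0 by (intro sum.mono_neutral_left) (force simp: T_def)+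
    have "T \<subset> S" using vp unfolding T_def by force
    moreover have "\<forall>i\<in>T. 0 < v i / s" using s by (auto simp: T_def)
    moreover have "(\<Sum>i\<in>T. v i / s) = 1"
      using sumT[of "\<lambda>_. 1"] s by (simp add: sum_divide_distrib[symmetric] s_def)
    moreover have "(\<Sum>i\<in>T. v i / s * f i j) \<le> (\<Sum>i\<in>S. w i * f i j)" if j: "j < n" for j
    proof -
      have "(\<Sum>i\<in>S. v i * f i j) = (\<Sum>i\<in>S. w i * f i j) - t * (\<Sum>i\<in>S. \<mu> i * f i j)"
        by (simp add: v_def algebra_simps sum_subtractf sum_distrib_left)
      then have eq: "(\<Sum>i\<in>S. v i * f i j) = (\<Sum>i\<in>S. w i * f i j)" using \<mu>f[OF j] by simp
      have "0 \<le> (\<Sum>i\<in>S. v i * f i j)"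
        using f j v0 by (intro sum_nonneg mult_nonneg_nonneg) auto
      then have "(\<Sum>i\<in>S. v i * f i j) / s \<le> (\<Sum>i\<in>S. v i * f i j)"
        using s by (simp add: divide_le_eq mult_le_cancel_left1)
      moreover have "(\<Sum>i\<in>T. v i / s * f i j) = (\<Sum>i\<in>S. v i * f i j) / s"
        using sumT[of "\<lambda>i. f i j"] by (simp add: sum_divide_distrib[symmetric])
      ultimately show ?thesis using eq by simp
    qed
    ultimately show ?thesis by (intro exI[of _ T] exI[of _ "\<lambda>i. v i / s"]) simp
  qed
qed

lemma conic_caratheodory:
  fixes f :: "'i \<Rightarrow> nat \<Rightarrow> real"
  assumes "finite S" "1 \<le> n" "\<And>i. i \<in> S \<Longrightarrow> 0 \<le> w i" "sum w S = 1"
    and "\<And>i j. i \<in> S \<Longrightarrow> j < n \<Longrightarrow> 0 \<le> f i j"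
  shows "\<exists>T w'. T \<subseteq> S \<and> card T \<le> n \<and> (\<forall>i\<in>T. 0 < w' i) \<and> sum w' T = 1 \<and>
     (\<forall>j<n. (\<Sum>i\<in>T. w' i * f i j) \<le> (\<Sum>i\<in>S. w i * f i j))"
proof -
  have reduce: "\<exists>T w'. T \<subseteq> S \<and> card T \<le> n \<and> (\<forall>i\<in>T. 0 < w' i) \<and> sum w' T = 1 \<and>
     (\<forall>j<n. (\<Sum>i\<in>T. w' i * f i j) \<le> (\<Sum>i\<in>S. w i * f i j))"
    if "finite S" "\<forall>i\<in>S. 0 < w i" "sum w S = 1" "\<forall>i\<in>S. \<forall>j<n. 0 \<le> f i j" for S and w :: "'i \<Rightarrow> real"
    using that
  proof (induction S arbitrary: w rule: finite_psubset_induct)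
    case (psubset S)
    show ?case
    proof (cases "card S \<le> n")
      case True
      then show ?thesis using psubset.prems by blast
    next
      case False
      then obtain T v where T: "T \<subset> S" "\<forall>i\<in>T. 0 < v i" "sum v T = 1"
        "\<forall>j<n. (\<Sum>i\<in>T. v i * f i j) \<le> (\<Sum>i\<in>S. w i * f i j)"
        using conic_caratheodory_step[of S n w f] psubset assms(2) by auto
      moreover have "\<forall>i\<in>T. \<forall>j<n. 0 \<le> f i j" using T(1) psubset.prems by blast
      ultimately obtain T' w' where "T' \<subseteq> T" "card T' \<le> n" "\<forall>i\<in>T'. 0 < w' i" "sum w' T' = 1"
        "\<forall>j<n. (\<Sum>i\<in>T'. w' i * f i j) \<le> (\<Sum>i\<in>T. v i * f i j)"
        using psubset.IH[of T v] by blast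
      then show ?thesis using T by (intro exI[of _ T'] exI[of _ w']) force
    qed
  qed
  \<comment> \<open>\<open>reduce\<close> works with positive weights, so points of weight 0 are
    dropped first.\<close>
  define R where "R = {i\<in>S. 0 < w i}"
  have sumR: "(\<Sum>i\<in>R. w i * h i) = (\<Sum>i\<in>S. w i * h i)" for h :: "'i \<Rightarrow> real"
    using assms(1,3) by (intro sum.mono_neutral_left) (force simp: R_def)+
  have "sum w R = 1" using sumR[of "\<lambda>_. 1"] assms(4) by simp
  moreover have "finite R" "R \<subseteq> S" "\<forall>i\<in>R. 0 < w i" using assms(1) by (auto simp: R_def)
  moreover have "\<forall>i\<in>R. \<forall>j<n. 0 \<le> f i j" using assms(5) \<open>R \<subseteq> S\<close> by blast
  ultimately obtain T w' where T: "T \<subseteq> R" "card T \<le> n" "\<forall>i\<in>T. 0 < w' i" "sum w' T = 1"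
     "\<forall>j<n. (\<Sum>i\<in>T. w' i * f i j) \<le> (\<Sum>i\<in>R. w i * f i j)"
    using reduce[of R w] by blast
  moreover have "T \<subseteq> S" using T \<open>R \<subseteq> S\<close> by blast
  ultimately show ?thesis by (intro exI[of _ T] exI[of _ w']) (simp add: sumR)
qed

section \<open>Subsets of at least average weight\<close>

text \<open>Removing a lightest element does not lower the average weight; this is repeated until
  \<open>m\<close> elements remain.\<close>

lemma exists_heavy_subset:
  fixes w :: "'i \<Rightarrow> real"
  assumes "finite S" "m \<le> card S"
  shows "\<exists>K\<subseteq>S. card K = m \<and> real m * sum w S \<le> real (card S) * sum w K"
  using assms
proof (induction S rule: finite_psubset_induct)
  case (psubset S)
  show ?case
  proof (cases "m = 0 \<or> m = card S")
    case True
    then show ?thesis by (auto intro: exI[of _ "{}"])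
  next
    case False
    then have m: "0 < m" "m < card S" using psubset.prems by auto
    then have "S \<noteq> {}" by auto
    then obtain e where e: "e \<in> S" "\<And>i. i \<in> S \<Longrightarrow> w e \<le> w i"
      using ex_is_arg_min_if_finite[OF psubset.hyps, of w] by (auto simp: is_arg_min_linorder)
    define T where "T = S - {e}"
    have T: "T \<subset> S" "card T = card S - 1" using e psubset.hyps by (auto simp: T_def)
    then obtain K where K: "K \<subseteq> T" "card K = m" "real m * sum w T \<le> real (card T) * sum w K"
      using psubset.IH[OF T(1)] m by fastforce
    have cT: "real (card T) = real (card S) - 1" "0 < real (card T)" using T m by auto
    have "real (card S) * w e \<le> sum w S" using sum_bounded_below[of S "w e" w] e by simp
    moreover have "real (card S) * sum w T = real (card S) * sum w S - real (card S) * w e"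
      using e psubset.hyps by (simp add: T_def sum_diff1 right_diff_distrib)
    ultimately have "real (card T) * sum w S \<le> real (card S) * sum w T"
      by (simp add: cT algebra_simps)
    then have "real m * (real (card T) * sum w S) \<le> real m * (real (card S) * sum w T)"
      by (simp add: mult_left_mono)
    also have "\<dots> \<le> real (card S) * (real (card T) * sum w K)"
      using mult_left_mono[OF K(3), of "real (card S)"] by (simp add: algebra_simps)
    finally have "real (card T) * (real m * sum w S) \<le> real (card T) * (real (card S) * sum w K)"
      by (simp add: algebra_simps)
    then have "real m * sum w S \<le> real (card S) * sum w K" using cT by simp
    then show ?thesis using K T by blast
  qed
qed

section \<open>Binary vectors and attained extrema\<close>

text \<open>Makes each second-stage set finite, as the alternative demands. A binary vector is
  determined by its support.\<close>

lemma finite_binary_vecs: "finite (binary_vecs n)"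
proof -
  define g :: "real vec \<Rightarrow> nat set" where "g v = {j. j < n \<and> v $ j = 1}" for v
  have "g ` binary_vecs n \<subseteq> Pow {..<n}" by (auto simp: g_def)
  then have fin: "finite (g ` binary_vecs n)" by (rule finite_subset) simp
  have inj: "inj_on g (binary_vecs n)"
  proof (rule inj_onI)
    fix u v
    assume u: "u \<in> binary_vecs n" and v: "v \<in> binary_vecs n" and eq: "g u = g v"
    have dim: "dim_vec u = n" "dim_vec v = n" using u v unfolding binary_vecs_def by auto
    show "u = v"
    proof (rule eq_vecI)
      fix j assume "j < dim_vec v"
      then have j: "j < n" using dim by simp
      have "u $ j = 1 \<longleftrightarrow> j \<in> g u" "v $ j = 1 \<longleftrightarrow> j \<in> g v" using j by (simp_all add: g_def)
      then have "u $ j = 1 \<longleftrightarrow> v $ j = 1" using eq by blast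
      moreover have "u $ j \<in> {0, 1}" "v $ j \<in> {0, 1}"
        using j u v unfolding binary_vecs_def by blast+
      ultimately show "u $ j = v $ j" by fastforce
    qed (use dim in simp)
  qed
  show ?thesis by (rule finite_imageD[OF fin inj])
qed

lemma nonneg_vecs_iff: "v \<in> nonneg_vecs n \<longleftrightarrow> dim_vec v = n \<and> (\<forall>j<n. 0 \<le> v $ j)"
  unfolding nonneg_vecs_def less_eq_vec_def carrier_vec_def by auto

text \<open>For binary \<open>y\<close>, the product adds up the entries of \<open>\<xi>\<close>
  over the support of \<open>y\<close>, which has \<open>norm0 y\<close> elements.\<close>

lemma binary_cost_bounds:
  assumes y: "y \<in> binary_vecs n" and \<xi>: "\<And>j. j < n \<Longrightarrow> m \<le> \<xi> $ j \<and> \<xi> $ j \<le> M"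
  shows "m * real (norm0 y) \<le> \<xi> \<bullet> y" "\<xi> \<bullet> y \<le> M * real (norm0 y)"
proof -
  define J where "J = {j. j < dim_vec y \<and> y $ j \<noteq> 0}"
  have n: "dim_vec y = n" using y by (auto simp: binary_vecs_def)
  have "\<xi> \<bullet> y = (\<Sum>j\<in>J. \<xi> $ j * y $ j)"
    unfolding scalar_prod_def by (intro sum.mono_neutral_right) (auto simp: J_def)
  also have "\<dots> = (\<Sum>j\<in>J. \<xi> $ j)"
    using y n by (intro sum.cong) (auto simp: J_def binary_vecs_def)
  finally have eq: "\<xi> \<bullet> y = (\<Sum>j\<in>J. \<xi> $ j)" .
  have c: "card J = norm0 y" by (simp add: J_def norm0_def)
  show "m * real (norm0 y) \<le> \<xi> \<bullet> y"
    using sum_bounded_below[of J m "\<lambda>j. \<xi> $ j"] \<xi> n unfolding eq c[symmetric]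
    by (force simp: J_def mult.commute)
  show "\<xi> \<bullet> y \<le> M * real (norm0 y)"
    using sum_bounded_above[of J "\<lambda>j. \<xi> $ j" M] \<xi> n unfolding eq c[symmetric]
    by (force simp: J_def mult.commute)
qed

lemma attains_min_on_INF:
  assumes "attains_min_on f A"
  obtains a where "a \<in> A" "(INF x\<in>A. f x) = f a" "\<And>b. b \<in> A \<Longrightarrow> f a \<le> f b"
proof -
  obtain a where a: "a \<in> A" "\<And>b. b \<in> A \<Longrightarrow> f a \<le> f b"
    using assms by (auto simp: attains_min_on_def)
  moreover have "(INF x\<in>A. f x) = f a" by (rule cInf_eq_minimum) (use a in auto)
  ultimately show ?thesis using that by blast
qed

lemma attains_max_on_SUP_upper:
  assumes "attains_max_on f A" "a \<in> A"
  shows "f a \<le> (SUP x\<in>A. f x)"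
proof (rule cSUP_upper[OF assms(2)])
  obtain b where "\<And>x. x \<in> A \<Longrightarrow> f x \<le> f b" using assms(1) by (auto simp: attains_max_on_def)
  then show "bdd_above (f ` A)" by (rule bdd_aboveI2)
qed

section \<open>Selecting few recourse solutions\<close>

text \<open>The core for a fixed first-stage decision: \<open>H - L\<close> plays the role of
  \<open>M n\<close>, \<open>\<alpha>\<close> that of \<open>a n\<close>, and the bound on
  \<open>l\<close> is stated without division.\<close>

lemma few_solutions_suffice:
  fixes Y U :: "real vec set" and c \<alpha> L H :: real
  assumes n: "1 \<le> n"
    and Y: "finite Y" "Y \<noteq> {}" "Y \<subseteq> nonneg_vecs n"
    and U: "U \<subseteq> nonneg_vecs n" "convex_vecs U"
    and c: "\<And>\<xi>. \<xi> \<in> U \<Longrightarrow> \<exists>y\<in>Y. \<xi> \<bullet> y \<le> c"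
    and bounds: "\<And>\<xi> y. \<xi> \<in> U \<Longrightarrow> y \<in> Y \<Longrightarrow> L \<le> \<xi> \<bullet> y \<and> \<xi> \<bullet> y \<le> H"
    and \<alpha>: "0 \<le> \<alpha>"
    and l: "l < n" "real l * (H - L + \<alpha>) \<le> \<alpha> * real n"
  shows "\<exists>K\<subseteq>Y. K \<noteq> {} \<and> card K \<le> n - l \<and> (\<forall>\<xi>\<in>U. \<exists>y\<in>K. \<xi> \<bullet> y \<le> c + \<alpha>)"
proof -
  have dimY: "dim_vec y = n" "\<And>j. j < n \<Longrightarrow> 0 \<le> y $ j" if "y \<in> Y" for y
    using that Y(3) nonneg_vecs_iff by blast+
  have dimU: "dim_vec u = n" "\<And>j. j < n \<Longrightarrow> 0 \<le> u $ j" if "u \<in> U" for u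
    using that U(1) nonneg_vecs_iff by blast+
  \<comment> \<open>\<open>convexlike\<close> quantifies over all vectors \<open>y\<close>, also of
    other dimensions. The explicit sum over \<open>j<n\<close> keeps \<open>f\<close> affine in
    \<open>\<xi>\<close> for each of them.\<close>
  define f where "f \<xi> y = (\<Sum>j<n. \<xi> $ j * y $ j) - c" for \<xi> y :: "real vec"
  have sp: "\<xi> \<bullet> y = (\<Sum>j<n. \<xi> $ j * y $ j)" if "y \<in> Y" for \<xi> y
    using dimY[OF that] by (simp add: scalar_prod_def atLeast0LessThan)
  have "convexlike f U"
    unfolding convexlike_def
  proof (intro ballI allI impI)
    fix u v :: "real vec" and s t :: real
    assume uv: "u \<in> U" "v \<in> U" and st: "0 \<le> s" "0 \<le> t" "s + t = 1"
    then have "s \<cdot>\<^sub>v u + t \<cdot>\<^sub>v v \<in> U" using U(2) by (auto simp: convex_vecs_def)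
    moreover have "f (s \<cdot>\<^sub>v u + t \<cdot>\<^sub>v v) i = s * f u i + t * f v i" for i
    proof -
      have "(\<Sum>j<n. (s \<cdot>\<^sub>v u + t \<cdot>\<^sub>v v) $ j * i $ j) =
          s * (\<Sum>j<n. u $ j * i $ j) + t * (\<Sum>j<n. v $ j * i $ j)"
        unfolding sum_distrib_left sum.distrib[symmetric] using dimU(1) uv
        by (intro sum.cong) (auto simp: algebra_simps)
      moreover have "c = s * c + t * c" using st by (simp flip: distrib_right)
      ultimately show ?thesis by (simp add: f_def algebra_simps)
    qed
    ultimately show "\<exists>w\<in>U. \<forall>i. f w i = s * f u i + t * f v i" by blast
  qed
  moreover have "\<exists>y\<in>Y. f \<xi> y \<le> 0" if "\<xi> \<in> U" for \<xi>
    using c[OF that] sp by (auto simp: f_def)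
  ultimately obtain w where w: "\<forall>y\<in>Y. 0 \<le> w y" "sum w Y = 1"
      "\<forall>\<xi>\<in>U. (\<Sum>y\<in>Y. w y * f \<xi> y) \<le> 0"
    using convexlike_alternative[OF Y(1,2), of f U] by blast
  obtain T v where T: "T \<subseteq> Y" "card T \<le> n" "\<forall>y\<in>T. 0 < v y" "sum v T = 1"
      "\<forall>j<n. (\<Sum>y\<in>T. v y * y $ j) \<le> (\<Sum>y\<in>Y. w y * y $ j)"
    using conic_caratheodory[OF Y(1) n, of w "\<lambda>y j. y $ j"] w(1,2) dimY(2) by blast
  have finT: "finite T" using T(1) Y(1) finite_subset by blast
  have Tne: "T \<noteq> {}" using T(4) by auto
  \<comment> \<open>The reduction lowers each coordinate of the combination, and
    \<open>\<xi>\<close> is nonnegative, so no cost grows.\<close>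
  have mix: "(\<Sum>y\<in>T. v y * (\<xi> \<bullet> y)) \<le> c" if \<xi>: "\<xi> \<in> U" for \<xi>
  proof -
    have swap: "(\<Sum>y\<in>A. g y * (\<Sum>j<n. \<xi> $ j * y $ j)) = (\<Sum>j<n. \<xi> $ j * (\<Sum>y\<in>A. g y * y $ j))"
      for A and g :: "real vec \<Rightarrow> real"
      unfolding sum_distrib_left by (subst sum.swap) (simp add: algebra_simps)
    have "(\<Sum>y\<in>T. v y * (\<xi> \<bullet> y)) = (\<Sum>y\<in>T. v y * (\<Sum>j<n. \<xi> $ j * y $ j))"
      using T(1) sp by (intro sum.cong) auto
    also have "\<dots> \<le> (\<Sum>y\<in>Y. w y * (\<Sum>j<n. \<xi> $ j * y $ j))"
      unfolding swap using T(5) dimU(2)[OF \<xi>] by (intro sum_mono mult_left_mono) auto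
    also have "\<dots> = (\<Sum>y\<in>Y. w y * f \<xi> y) + c * sum w Y"
      by (simp add: f_def algebra_simps sum_subtractf sum_distrib_left)
    also have "\<dots> \<le> c" using w \<xi> by simp
    finally show ?thesis .
  qed
  \<comment> \<open>The reduced set may have fewer than \<open>n - l\<close> elements; then all of
    them are kept.\<close>
  define m where "m = min (n - l) (card T)"
  obtain K where K: "K \<subseteq> T" "card K = m" "real m * sum v T \<le> real (card T) * sum v K"
    using exists_heavy_subset[OF finT, of m v] by (auto simp: m_def)
  have cT: "0 < card T" using finT Tne by (simp add: card_gt_0_iff)
  then have m: "0 < m" using l by (simp add: m_def)
  then have Kne: "K \<noteq> {}" using K(2) by auto
  have finK: "finite K" using K(1) finT finite_subset by blast
  define \<kappa> where "\<kappa> = sum v K"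
  have \<kappa>1: "\<kappa> \<le> 1" unfolding \<kappa>_def T(4)[symmetric]
    using K(1) finT T(3) by (intro sum_mono2) (auto intro: less_imp_le)
  have \<kappa>0: "0 < \<kappa>" unfolding \<kappa>_def using Kne finK K(1) T(3) by (intro sum_pos) auto
  have \<kappa>: "(1 - \<kappa>) * real n \<le> real l"
  proof (cases "card T \<le> n - l")
    case True
    then have "K = T" using K finT by (simp add: m_def card_subset_eq)
    then show ?thesis by (simp add: \<kappa>_def T(4))
  next
    case False
    then have "real n - real l \<le> real (card T) * \<kappa>"
      using K(3) l T(4) by (simp add: m_def \<kappa>_def)
    also have "\<dots> \<le> real n * \<kappa>" using T(2) \<kappa>0 by simp
    finally show ?thesis by (simp add: algebra_simps)
  qed
  have "\<exists>y\<in>K. \<xi> \<bullet> y \<le> c + \<alpha>" if \<xi>: "\<xi> \<in> U" for \<xi>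
  proof (rule ccontr)
    assume "\<not> ?thesis"
    then have exp: "c + \<alpha> < \<xi> \<bullet> y" if "y \<in> K" for y using that by force
    obtain y where y: "y \<in> K" using Kne by blast
    then have bnd: "L \<le> H" "c + \<alpha> < H" using bounds[OF \<xi>, of y] exp[OF y] K(1) T(1) by force+
    have "(c + \<alpha>) * \<kappa> < (\<Sum>y\<in>K. v y * (\<xi> \<bullet> y))"
      unfolding \<kappa>_def sum_distrib_left using finK Kne exp T(3) K(1)
      by (intro sum_strict_mono) (auto simp: mult.commute)
    moreover have "L * (1 - \<kappa>) \<le> (\<Sum>y\<in>T - K. v y * (\<xi> \<bullet> y))"
    proof -
      have "1 - \<kappa> = sum v (T - K)" using K(1) finT by (simp add: sum_diff \<kappa>_def T(4))
      then show ?thesis using bounds[OF \<xi>] T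
        by (auto simp: sum_distrib_left mult.commute intro!: sum_mono mult_left_mono)
    qed
    moreover have "(\<Sum>y\<in>T. v y * (\<xi> \<bullet> y)) =
        (\<Sum>y\<in>T - K. v y * (\<xi> \<bullet> y)) + (\<Sum>y\<in>K. v y * (\<xi> \<bullet> y))"
      using sum.subset_diff[OF K(1) finT] .
    \<comment> \<open>The average cost is at most \<open>c\<close>, while kept solutions exceed
      \<open>c + \<alpha>\<close> and discarded ones cost at least \<open>L\<close>. Splitting
      \<open>(c + \<alpha>) * \<kappa>\<close> as
      \<open>(c + \<alpha>) - (1 - \<kappa>) * (c + \<alpha>)\<close> isolates
      \<open>\<alpha>\<close>.\<close>
    ultimately have "(c + \<alpha>) * \<kappa> + L * (1 - \<kappa>) < c" using mix[OF \<xi>] by linarith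
    moreover have "(1 - \<kappa>) * (c + \<alpha>) \<le> (1 - \<kappa>) * H" using bnd \<kappa>1 by (intro mult_left_mono) auto
    ultimately have less: "\<alpha> < (1 - \<kappa>) * (H - L)" by (simp add: algebra_simps)
    have "(1 - \<kappa>) * real n * (H - L + \<alpha>) \<le> real l * (H - L + \<alpha>)"
      using \<kappa> bnd \<alpha> by (intro mult_right_mono) auto
    also note l(2)
    finally have "real n * ((1 - \<kappa>) * (H - L + \<alpha>)) \<le> real n * \<alpha>" by (simp add: algebra_simps)
    then have "(1 - \<kappa>) * (H - L + \<alpha>) \<le> \<alpha>" using n by simp
    moreover have "0 \<le> (1 - \<kappa>) * \<alpha>" using \<kappa>1 \<alpha> by simp
    ultimately show False using less by (simp add: algebra_simps)
  qed
  moreover have "K \<subseteq> Y" "card K \<le> n - l" using K(1,2) T(1) by (auto simp: m_def)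
  ultimately show ?thesis using Kne by blast
qed

section \<open>Transfer to the two robust problems\<close>

theorem lemma18:
  fixes C :: "ro_instance set" and I :: ro_instance
    and p_lo p_up a M :: "nat \<Rightarrow> real" and m_inf M_inf :: real
    and n k l :: nat
  assumes "\<forall>J\<in>C. valid_instance J"
    and "cardinality_bounds C p_lo p_up"
    and "I \<in> C"
    and "n = snd_dim I"
    and "cost_bounds I m_inf M_inf"
    and "\<And>j. M j = M_inf * p_up j - m_inf * p_lo j"
    and "nonneg_seq a"
    and "M n + a n > 0"
    and "real l \<le> min (real n - 1) (a n * real n / (M n + a n))"
    and "k = n - l"
    and "two_stage_attained I"
    and "adapt_attained I k"
  shows "adapt I k \<le> opt_2RO I + a n"
proof -
  have "valid_instance I" using assms(1,3) by blast
  then have n: "1 \<le> n" and U: "uncertainty I \<noteq> {}" "uncertainty I \<subseteq> nonneg_vecs n"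
      "convex_vecs (uncertainty I)"
    and YI: "\<And>x. x \<in> fst_stage I \<Longrightarrow> snd_stage I x \<noteq> {} \<and> snd_stage I x \<subseteq> binary_vecs n"
    unfolding valid_instance_def assms(4)[symmetric] by simp_all
  obtain x where x: "x \<in> fst_stage I" "opt_2RO I = worst_case I x"
    using assms(11) attains_min_on_INF[of "worst_case I" "fst_stage I"]
    unfolding two_stage_attained_def opt_2RO_def by metis
  define Y where "Y = snd_stage I x"
  have Y: "finite Y" "Y \<noteq> {}" "Y \<subseteq> binary_vecs n"
    using YI[OF x(1)] finite_subset[OF _ finite_binary_vecs] by (auto simp: Y_def)
  \<comment> \<open>The second-stage budget that remains once the optimal \<open>x\<close> is paid
    for.\<close>
  define c where "c = opt_2RO I - fst_cost I \<bullet> x"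
  have "\<exists>y\<in>Y. \<xi> \<bullet> y \<le> c" if \<xi>: "\<xi> \<in> uncertainty I" for \<xi>
  proof -
    have "Min (total_cost I x \<xi> ` Y) \<in> total_cost I x \<xi> ` Y" using Y by (intro Min_in) auto
    moreover have "recourse_cost I x \<xi> = Min (total_cost I x \<xi> ` Y)"
      unfolding recourse_cost_def Y_def[symmetric] using Y by (intro cInf_eq_Min) auto
    moreover have "recourse_cost I x \<xi> \<le> opt_2RO I"
      unfolding x(2) worst_case_def using assms(11) x(1) \<xi>
      by (intro attains_max_on_SUP_upper) (auto simp: two_stage_attained_def)
    ultimately obtain y where "y \<in> Y" "total_cost I x \<xi> y \<le> opt_2RO I" by auto
    then show ?thesis by (intro bexI[of _ y]) (simp_all add: c_def total_cost_def)
  qed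
  moreover have "m_inf * p_lo n \<le> \<xi> \<bullet> y \<and> \<xi> \<bullet> y \<le> M_inf * p_up n"
    if \<xi>: "\<xi> \<in> uncertainty I" and y: "y \<in> Y" for \<xi> y
  proof -
    have m: "0 < m_inf" "m_inf \<le> M_inf" and *: "\<And>j. j < n \<Longrightarrow> m_inf \<le> \<xi> $ j \<and> \<xi> $ j \<le> M_inf"
      using assms(4,5) \<xi> by (auto simp: cost_bounds_def)
    have "p_lo n \<le> real (norm0 y)" "real (norm0 y) \<le> p_up n"
      using assms(2-4) x(1) y by (auto simp: cardinality_bounds_def Y_def)
    then have "m_inf * p_lo n \<le> m_inf * real (norm0 y)" "M_inf * real (norm0 y) \<le> M_inf * p_up n"
      using m by (auto intro: mult_left_mono)
    then show ?thesis using binary_cost_bounds[OF _ *, of y] y Y(3) by (meson order_trans subsetD)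
  qed
  moreover have "Y \<subseteq> nonneg_vecs n"
    using Y(3) by (force simp: binary_vecs_def nonneg_vecs_iff)
  moreover have a0: "0 \<le> a n" using assms(7) n by (simp add: nonneg_seq_def)
  moreover have l: "l < n" using assms(9) n by linarith
  moreover have "real l * (M_inf * p_up n - m_inf * p_lo n + a n) \<le> a n * real n"
    using assms(6)[of n] assms(8,9) by (simp add: le_divide_eq)
  ultimately obtain K where K: "K \<subseteq> Y" "K \<noteq> {}" "card K \<le> k"
      "\<And>\<xi>. \<xi> \<in> uncertainty I \<Longrightarrow> \<exists>y\<in>K. \<xi> \<bullet> y \<le> c + a n"
    using few_solutions_suffice[OF n Y(1,2) _ U(2,3), of c "m_inf * p_lo n" "M_inf * p_up n" "a n" l]
      assms(10) by blast
  have finK: "finite K" using K(1) Y(1) finite_subset by blast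
  obtain e where e: "bij_betw e {1..card K} K"
    using ex_bij_betw_nat_finite_1[OF finK] by blast
  obtain y0 where y0: "y0 \<in> K" using K(2) by blast
  \<comment> \<open>\<open>K\<close> may have fewer than \<open>k\<close> elements, so surplus
    indices repeat \<open>y0\<close>. The restriction makes the family extensional, as feasibility
    requires.\<close>
  define ys where "ys = restrict (\<lambda>i. if i \<le> card K then e i else y0) {1..k}"
  have ysK: "ys i \<in> K" if "i \<in> {1..k}" for i
    using that bij_betwE[OF e] y0 by (auto simp: ys_def)
  have surj: "\<exists>i\<in>{1..k}. ys i = y" if "y \<in> K" for y
  proof -
    have "y \<in> e ` {1..card K}" using that bij_betw_imp_surj_on[OF e] by simp
    then obtain i where i: "i \<in> {1..card K}" "y = e i" by (rule imageE)
    then have "i \<in> {1..k}" using K(3) by simp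
    moreover from this have "ys i = y" using i by (simp add: ys_def)
    ultimately show ?thesis by blast
  qed
  have feas: "(x, ys) \<in> adapt_feasible I k"
  proof -
    have "ys i \<in> snd_stage I x" if "i \<in> {1..k}" for i
      using ysK[OF that] K(1) unfolding Y_def by blast
    moreover have "ys \<in> extensional {1..k}" unfolding ys_def by (rule restrict_extensional)
    ultimately have "ys \<in> {1..k} \<rightarrow>\<^sub>E snd_stage I x" unfolding PiE_iff by blast
    then show ?thesis using x(1) by (simp add: adapt_feasible_def)
  qed
  \<comment> \<open>Attainment makes the infimum a true minimum, hence a lower bound for this
    feasible point.\<close>
  have "adapt I k \<le> adapt_worst_case I k (x, ys)"
    using assms(12) attains_min_on_INF[of "adapt_worst_case I k" "adapt_feasible I k"] feas
    unfolding adapt_attained_def adapt_def by metis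
  also have "\<dots> \<le> opt_2RO I + a n"
    unfolding adapt_worst_case_def
  proof (rule cSUP_least[OF U(1)])
    fix \<xi> assume "\<xi> \<in> uncertainty I"
    then obtain y where y: "y \<in> K" "\<xi> \<bullet> y \<le> c + a n" using K(4) by blast
    then obtain i where i: "i \<in> {1..k}" "ys i = y" using surj by blast
    have "adapt_recourse_cost I k (x, ys) \<xi> \<le> total_cost I x \<xi> (ys i)"
      unfolding adapt_recourse_cost_def prod.case using i(1) by (intro cINF_lower) auto
    also have "\<dots> \<le> opt_2RO I + a n" using y i by (simp add: total_cost_def c_def)
    finally show "adapt_recourse_cost I k (x, ys) \<xi> \<le> opt_2RO I + a n" .
  qed
  finally show ?thesis .
qed

end
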